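(* Let $\lambda>0$, $\Delta t>0$, let $G$ be a service-time distribution with cumulative distribution function $F_G$, and let $p_\lambda=1-e^{-\lambda\Delta t}$ and $p_\mu=F_G(\Delta t)$ be the probabilities of an arrival and of a service completion in a time interval of length $\Delta t$. Let $A(\lambda,\Delta t)=R_y(\theta_\lambda)$ and $S(\mu,\Delta t)=R_y(\theta_\mu)$ be the arrival and service gates, with rotation angles $\theta_\lambda=2\arcsin\sqrt{p_\lambda}$ and $\theta_\mu=2\arcsin\sqrt{p_\mu}$. Then $A(\lambda,\Delta t)$ and $S(\mu,\Delta t)$ are unitary, and the rotation angle $2\arcsin(\sqrt{p})$ realizes the transition probability $p$ of the corresponding event: measuring $A(\lambda,\Delta t)|0\rangle$ (respectively $S(\mu,\Delta t)|0\rangle$) in the computational basis gives the outcome $1$ with probability $p_\lambda$ (respectively $p_\mu$).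
   Context: $|0\rangle,|1\rangle$ is the computational basis of $\mathbb{C}^2$, and for real $\theta$ $$R_y(\theta)=\begin{pmatrix}\cos(\theta/2)&-\sin(\theta/2)\\ \sin(\theta/2)&\cos(\theta/2)\end{pmatrix}.$$ Measuring a unit vector $\alpha|0\rangle+\beta|1\rangle$ in the computational basis gives outcome $1$ with probability $|\beta|^2$. The letter $\mu$ in $S(\mu,\Delta t)$ is the service rate $1/\mathbb{E}[G]$ and serves only as a label for the service distribution $G$. *)

theory Defs
  imports "HOL-Probability.Probability"
begin

(* The component of a vector of type complex ^ 2 at index 1 is the amplitude of |0>,
   the component at index 2 is the amplitude of |1>. *)
definition ket0 :: "complex ^ 2" where
  "ket0 = axis 1 1"

definition ket1 :: "complex ^ 2" where
  "ket1 = axis 2 1"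

definition prob_outcome_one :: "complex ^ 2 \<Rightarrow> real" where
  "prob_outcome_one \<psi> = (cmod (\<psi> $ 2))\<^sup>2"

lemma prob_outcome_one_superposition:
  "prob_outcome_one (\<alpha> *s ket0 + \<beta> *s ket1) = (cmod \<beta>)\<^sup>2"
  by (simp add: prob_outcome_one_def ket0_def ket1_def axis_def)

definition conj_transpose :: "complex ^ 'n ^ 'm \<Rightarrow> complex ^ 'm ^ 'n" where
  "conj_transpose A = (\<chi> i j. cnj (A $ j $ i))"

definition unitary :: "complex ^ 'n ^ 'n \<Rightarrow> bool" where
  "unitary U \<longleftrightarrow> conj_transpose U ** U = mat 1 \<and> U ** conj_transpose U = mat 1"

definition R_y :: "real \<Rightarrow> complex ^ 2 ^ 2" where
  "R_y \<theta> = vector [vector [complex_of_real (cos (\<theta> / 2)), - complex_of_real (sin (\<theta> / 2))],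
                    vector [complex_of_real (sin (\<theta> / 2)), complex_of_real (cos (\<theta> / 2))]]"

definition rotation_angle :: "real \<Rightarrow> real" where
  "rotation_angle p = 2 * arcsin (sqrt p)"

definition arrival_prob :: "real \<Rightarrow> real \<Rightarrow> real" where
  "arrival_prob lam \<Delta>t = 1 - exp (- lam * \<Delta>t)"

definition service_prob :: "real measure \<Rightarrow> real \<Rightarrow> real" where
  "service_prob G \<Delta>t = cdf G \<Delta>t"

definition arrival_gate :: "real \<Rightarrow> real \<Rightarrow> complex ^ 2 ^ 2" where
  "arrival_gate lam \<Delta>t = R_y (rotation_angle (arrival_prob lam \<Delta>t))"

(* The gate S(mu, Delta t). The rate mu = 1/E[G] only labels the service distribution,
   so the distribution G itself is the argument. *)
definition service_gate :: "real measure \<Rightarrow> real \<Rightarrow> complex ^ 2 ^ 2" where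
  "service_gate G \<Delta>t = R_y (rotation_angle (service_prob G \<Delta>t))"

(* A probability law on the Borel sets of the reals that is concentrated on [0, \<infinity>). *)
definition service_distribution :: "real measure \<Rightarrow> bool" where
  "service_distribution G \<longleftrightarrow> real_distribution G \<and> (AE x in G. 0 \<le> x)"

end

theory Submission
  imports Defs
begin

text \<open>Unitarity holds for every angle, by cos^2 + sin^2 = 1. The first column of
  \<open>R_y\<close> gives |1> the amplitude sin(\<theta>/2), so outcome 1 has probability
  sin^2(\<theta>/2), which is p at \<open>rotation_angle p\<close> as soon as p lies in [0,1]
  (\<open>prob_outcome_one_R_y_rotation_angle\<close>).\<close>

lemma unitary_R_y: "unitary (R_y \<theta>)"
proof -
  \<comment> \<open>The diagonal entries of both products, in the form in which they arise there;
    the off-diagonal entries cancel.\<close>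
  have "complex_of_real (cos x) * complex_of_real (cos x) +
      complex_of_real (sin x) * complex_of_real (sin x) = 1" for x
    unfolding of_real_mult[symmetric] of_real_add[symmetric]
    by (simp add: power2_eq_square[symmetric])
  then show ?thesis
    by (simp add: unitary_def conj_transpose_def R_y_def matrix_matrix_mult_def mat_def
        vec_eq_iff forall_2 sum_2 add.commute)
qed

lemma R_y_ket0:
  "R_y \<theta> *v ket0 = vector [complex_of_real (cos (\<theta> / 2)), complex_of_real (sin (\<theta> / 2))]"
  by (simp add: R_y_def ket0_def matrix_vector_mult_def axis_def vec_eq_iff forall_2 sum_2)

text \<open>The measurement rule applies to unit vectors, so this justifies reading
  \<open>prob_outcome_one\<close> as a probability.\<close>

lemma norm_R_y_ket0: "norm (R_y \<theta> *v ket0) = 1"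
  by (simp add: R_y_ket0 norm_vec_def L2_set_def sum_2)

lemma prob_outcome_one_R_y_rotation_angle:
  assumes "0 \<le> p" "p \<le> 1"
  shows "prob_outcome_one (R_y (rotation_angle p) *v ket0) = p"
proof -
  have "sin (arcsin (sqrt p)) = sqrt p"
    \<comment> \<open>\<open>arcsin\<close> is inverted by \<open>sin\<close> on [-1,1]; the lower
      bound -1 is reached through 0 \<le> sqrt p.\<close>
    using assms by (intro sin_arcsin) (auto intro: order_trans[of _ 0])
  then show ?thesis
    using assms by (simp add: R_y_ket0 prob_outcome_one_def rotation_angle_def)
qed

theorem theorem1:
  fixes lam \<Delta>t :: real and G :: "real measure"
  assumes "lam > 0" and "\<Delta>t > 0" and "service_distribution G"
  shows "unitary (arrival_gate lam \<Delta>t) \<and> unitary (service_gate G \<Delta>t) \<and>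
    norm (arrival_gate lam \<Delta>t *v ket0) = 1 \<and>
    prob_outcome_one (arrival_gate lam \<Delta>t *v ket0) = arrival_prob lam \<Delta>t \<and>
    norm (service_gate G \<Delta>t *v ket0) = 1 \<and>
    prob_outcome_one (service_gate G \<Delta>t *v ket0) = service_prob G \<Delta>t"
proof -
  interpret real_distribution G
    using assms(3) by (simp add: service_distribution_def)
  have "0 \<le> arrival_prob lam \<Delta>t" "arrival_prob lam \<Delta>t \<le> 1"
    using assms(1,2) by (simp_all add: arrival_prob_def)
  \<comment> \<open>The cdf value is the mass of a half-line under a probability measure.\<close>
  moreover have "0 \<le> service_prob G \<Delta>t" "service_prob G \<Delta>t \<le> 1"
    by (simp_all add: service_prob_def cdf_nonneg cdf_bounded_prob)
  ultimately show ?thesis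
    unfolding arrival_gate_def service_gate_def
    by (simp add: unitary_R_y norm_R_y_ket0 prob_outcome_one_R_y_rotation_angle)
qed

end
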